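(* Let $m\ge 3$ and let $(A,+,\circ)$ be a modular maximal-cyclic (MMC) brace of size $2^{m+2}$ whose additive group $(A,+)$ is not cyclic. Then $(A,+)\cong \mathbb{Z}/2\times\mathbb{Z}/2^{m+1}$.
   Context: A (right) brace is a set $A$ with two group structures $+$ and $\circ$ such that $(A,+)$ is abelian and $(b+c)\circ a+a=b\circ a+c\circ a$ for all $a,b,c\in A$. The group $(A,\circ)$ is called the adjoint group. A modular maximal-cyclic (MMC) brace of size $2^{m+2}$ is a brace whose adjoint group is isomorphic to the modular maximal-cyclic group $M_{2^{m+2}}=\langle a,b\mid a^{2^{m+1}}=b^2=1,\ bab^{-1}=a^{1+2^m}\rangle$. An MMC brace is called cyclic (resp. non-cyclic) if its additive group is cyclic (resp. not cyclic). *)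

theory Defs
  imports "HOL-Algebra.Ring" "HOL-Algebra.Elementary_Groups"
begin

section \<open>Groups given by generators and relations\<close>

text \<open>
  A letter \<open>(g, True)\<close> stands for the generator \<open>g\<close> and \<open>(g, False)\<close> for its formal inverse.
  A pair \<open>(u, v)\<close> in \<open>R\<close> stands for the relation \<open>u = v\<close>, so with \<open>R\<close> empty the group below is
  the free group on the whole type \<open>'g\<close>.
\<close>

type_synonym 'g word = "('g \<times> bool) list"

inductive pres_eq :: "('g word \<times> 'g word) set \<Rightarrow> 'g word \<Rightarrow> 'g word \<Rightarrow> bool"
  for R where
  refl: "pres_eq R u u"
| sym: "pres_eq R u v \<Longrightarrow> pres_eq R v u"
| trans: "pres_eq R u v \<Longrightarrow> pres_eq R v w \<Longrightarrow> pres_eq R u w"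
| append: "pres_eq R u v \<Longrightarrow> pres_eq R u' v' \<Longrightarrow> pres_eq R (u @ u') (v @ v')"
| cancel: "pres_eq R [(g, s), (g, \<not> s)] []"
| rel: "(u, v) \<in> R \<Longrightarrow> pres_eq R u v"

definition pres_rel :: "('g word \<times> 'g word) set \<Rightarrow> ('g word \<times> 'g word) set" where
  "pres_rel R = {(u, v). pres_eq R u v}"

definition presented_group :: "('g word \<times> 'g word) set \<Rightarrow> 'g word set monoid" where
  "presented_group R =
     \<lparr>carrier = UNIV // pres_rel R,
      mult = (\<lambda>X Y. \<Union>u\<in>X. \<Union>v\<in>Y. pres_rel R `` {u @ v}),
      one = pres_rel R `` {[]}\<rparr>"

lemma equiv_pres_rel: "equiv UNIV (pres_rel R)"
  by (auto simp: equiv_def refl_on_def sym_def trans_def pres_rel_def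
      intro: pres_eq.refl pres_eq.sym pres_eq.trans)

lemma presented_group_mult:
  "pres_rel R `` {u} \<otimes>\<^bsub>presented_group R\<^esub> pres_rel R `` {v} = pres_rel R `` {u @ v}"
proof -
  have "(\<lambda>u v. pres_rel R `` {u @ v}) respects2 (pres_rel R)"
    by (rule congruent2I', rule equiv_class_eq[OF equiv_pres_rel])
      (simp add: pres_rel_def pres_eq.append)
  then show ?thesis
    by (simp add: presented_group_def UN_equiv_class2[OF equiv_pres_rel equiv_pres_rel])
qed

lemma presented_group_left_inverse:
  "pres_eq R (rev (map (\<lambda>(g, s). (g, \<not> s)) u) @ u) []"
proof (induction u)
  case Nil
  show ?case by (simp add: pres_eq.refl)
next
  case (Cons x u)
  obtain g s where x: "x = (g, s)" by (cases x)
  let ?w = "rev (map (\<lambda>(g, s). (g, \<not> s)) u)"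
  have "pres_eq R [(g, \<not> s), (g, s)] []"
    using pres_eq.cancel[of R g "\<not> s"] by simp
  then have "pres_eq R ([(g, \<not> s), (g, s)] @ u) ([] @ u)"
    by (rule pres_eq.append) (rule pres_eq.refl)
  then have "pres_eq R (?w @ ([(g, \<not> s), (g, s)] @ u)) (?w @ ([] @ u))"
    by (rule pres_eq.append[OF pres_eq.refl])
  then show ?case
    using pres_eq.trans[OF _ Cons.IH] x by simp
qed

lemma group_presented_group: "group (presented_group R)"
proof (rule groupI)
  let ?G = "presented_group R"
  have car: "\<exists>u. X = pres_rel R `` {u}" if "X \<in> carrier ?G" for X
    using that by (auto simp: presented_group_def elim: quotientE)
  have incar: "pres_rel R `` {u} \<in> carrier ?G" for u
    by (simp add: presented_group_def quotientI)
  have one: "\<one>\<^bsub>?G\<^esub> = pres_rel R `` {[]}"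
    by (simp add: presented_group_def)
  show "\<one>\<^bsub>?G\<^esub> \<in> carrier ?G"
    by (simp add: one incar)
  fix X assume X: "X \<in> carrier ?G"
  then obtain u where u: "X = pres_rel R `` {u}" using car by blast
  show "\<one>\<^bsub>?G\<^esub> \<otimes>\<^bsub>?G\<^esub> X = X"
    by (simp add: one u presented_group_mult)
  have "pres_rel R `` {rev (map (\<lambda>(g, s). (g, \<not> s)) u)} \<otimes>\<^bsub>?G\<^esub> X = \<one>\<^bsub>?G\<^esub>"
    unfolding u one presented_group_mult
    by (rule equiv_class_eq[OF equiv_pres_rel]) (simp add: pres_rel_def presented_group_left_inverse)
  then show "\<exists>Y\<in>carrier ?G. Y \<otimes>\<^bsub>?G\<^esub> X = \<one>\<^bsub>?G\<^esub>"
    using incar by blast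
  fix Y assume Y: "Y \<in> carrier ?G"
  then obtain v where v: "Y = pres_rel R `` {v}" using car by blast
  show "X \<otimes>\<^bsub>?G\<^esub> Y \<in> carrier ?G"
    by (simp add: u v presented_group_mult incar)
  fix Z assume "Z \<in> carrier ?G"
  then obtain w where w: "Z = pres_rel R `` {w}" using car by blast
  show "X \<otimes>\<^bsub>?G\<^esub> Y \<otimes>\<^bsub>?G\<^esub> Z = X \<otimes>\<^bsub>?G\<^esub> (Y \<otimes>\<^bsub>?G\<^esub> Z)"
    by (simp add: u v w presented_group_mult)
qed


section \<open>The modular maximal-cyclic group of order \<open>2 ^ (m + 2)\<close>\<close>

datatype mmc_gen = Gen_a | Gen_b

definition mmc_rels :: "nat \<Rightarrow> (mmc_gen word \<times> mmc_gen word) set" where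
  "mmc_rels m =
     {(replicate (2 ^ (m + 1)) (Gen_a, True), []),
      (replicate 2 (Gen_b, True), []),
      ([(Gen_b, True), (Gen_a, True), (Gen_b, False)], replicate (1 + 2 ^ m) (Gen_a, True))}"

definition mmc_group :: "nat \<Rightarrow> mmc_gen word set monoid" where
  "mmc_group m = presented_group (mmc_rels m)"


section \<open>Braces\<close>

text \<open>
  A right brace is stored in a ring record whose \<open>\<oplus>\<close> is the brace addition and whose \<open>\<otimes>\<close> is the
  circle operation \<open>\<circ>\<close>, not a ring multiplication. Thus \<open>add_monoid A\<close> is the additive group, and
  \<open>A\<close> itself, used as a monoid record, is the adjoint group.
\<close>

locale brace = abelian_group A + group A for A (structure) +
  assumes brace_law:
    "\<lbrakk>a \<in> carrier A; b \<in> carrier A; c \<in> carrier A\<rbrakk>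
       \<Longrightarrow> (b \<oplus> c) \<otimes> a \<oplus> a = b \<otimes> a \<oplus> c \<otimes> a"

text \<open>\<open>mmc_brace m A\<close> says that \<open>A\<close> is an MMC brace of size \<open>2 ^ (m + 2)\<close>; the size is forced by
  the isomorphism with \<open>mmc_group m\<close>.\<close>

locale mmc_brace = brace A for m :: nat and A (structure) +
  assumes adjoint_iso: "A \<cong> mmc_group m"

end

theory Submission
  imports Defs "HOL-Algebra.Multiplicative_Group" "HOL-Computational_Algebra.Polynomial"
    "HOL-Computational_Algebra.Primes"
begin

text \<open>
  Put \<open>n = m + 2\<close> and let \<open>a\<close> have order \<open>2 ^ (n - 1)\<close> in the adjoint group. The adjoint group acts on
  \<open>(A, +)\<close> by \<open>x \<mapsto> x \<circ> b - b\<close>; if \<open>1 + X\<close> acts as \<open>a\<close> does, then the circle power of \<open>a\<close> with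
  exponent \<open>2 ^ k\<close> is \<open>q k \<cdot> a\<close> with \<open>q 0 = 1\<close> and \<open>q (k + 1) = q k * (2 + X * q k)\<close>. So \<open>\<int>[X] a\<close> is a cyclic
  module over a local ring with maximal ideal \<open>(2, X)\<close>, and by Nakayama the submodules generated by
  \<open>q 0, \<dots>, q (n - 2)\<close> form a strictly decreasing chain of nonzero subgroups of a group of order
  at most \<open>2 ^ n\<close>. Hence at most one step of the chain has index four and all others have index two. At
  an index-two step \<open>(2, X) q k\<close> is generated by \<open>q (k + 1)\<close>; inspecting the first three steps, which exist
  since \<open>n \<ge> 5\<close>, yields \<open>2 ^ (n - 2) a \<noteq> 0\<close>. A non-cyclic abelian group of order at most \<open>2 ^ n\<close> with an
  element of order at least \<open>2 ^ (n - 1)\<close> is \<open>\<int>/2 \<times> \<int>/2 ^ (n - 1)\<close>.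
\<close>

section \<open>Orbits of an element under polynomials in an endomorphism\<close>

lemma diff_dvd_power_diff:
  fixes x y :: "'a :: comm_ring_1"
  shows "x - y dvd x ^ n - y ^ n"
  by (simp add: power_diff_sumr2)

definition polyX :: "int poly" where
  "polyX = [:0, 1:]"

lemma poly_polyX [simp]: "poly polyX 0 = 0"
  by (simp add: polyX_def)

lemma pCons_polyX: "pCons c p = of_int c + polyX * p"
  by (simp add: polyX_def of_int_poly)

locale polynomial_orbit = comm_group G for G (structure) +
  fixes D :: "'a \<Rightarrow> 'a" and a :: 'a
  assumes D_hom: "D \<in> hom G G"
    and a_closed: "a \<in> carrier G"
begin

text \<open>Horner evaluation of \<open>p(D)\<close> at \<open>a\<close>: the \<int>[X]-linear map
  that sends 1 to \<open>a\<close> and lets X act as \<open>D\<close>, with the abelian group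
  written multiplicatively.\<close>

definition orb :: "int poly \<Rightarrow> 'a" where
  "orb p = fold_coeffs (\<lambda>c y. a [^] c \<otimes> D y) p \<one>"

lemma D_closed: "x \<in> carrier G \<Longrightarrow> D x \<in> carrier G"
  using D_hom by (auto simp: hom_def)

lemma D_mult: "x \<in> carrier G \<Longrightarrow> y \<in> carrier G \<Longrightarrow> D (x \<otimes> y) = D x \<otimes> D y"
  using D_hom by (auto simp: hom_def)

lemma D_one: "D \<one> = \<one>"
  using hom_one[OF D_hom is_group is_group] .

lemma D_int_pow: "x \<in> carrier G \<Longrightarrow> D (x [^] (k::int)) = D x [^] k"
  using int_pow_mult hom_int_pow[OF D_hom _ is_group is_group] by blast

lemma orb_0 [simp]: "orb 0 = \<one>"
  by (simp add: orb_def)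

lemma orb_pCons [simp]: "orb (pCons c p) = a [^] c \<otimes> D (orb p)"
  by (cases "c = 0 \<and> p = 0") (auto simp: orb_def D_one fold_coeffs_pCons_coeff_not_0_eq
      fold_coeffs_pCons_not_0_0_eq)

lemma orb_closed [simp, intro]: "orb p \<in> carrier G"
  by (induction p) (auto simp: D_closed a_closed)

lemma orb_add: "orb (p + q) = orb p \<otimes> orb q"
proof (induction p q rule: poly_induct2)
  case (pCons c p d q)
  then show ?case
    by (simp add: D_mult int_pow_mult a_closed D_closed m_ac)
qed simp

lemma orb_smult: "orb (smult k p) = orb p [^] k"
proof (induction p)
  case (pCons c p)
  then show ?case
    by (simp add: int_pow_distrib a_closed D_closed D_int_pow int_pow_pow mult.commute)
qed (simp)

text \<open>With \<open>orb_add\<close> this makes the polynomials annihilating \<open>a\<close> an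
  ideal, so equality under \<open>orb\<close> is congruence modulo that ideal.\<close>

lemma orb_mult_eq_one: "orb p = \<one> \<Longrightarrow> orb (r * p) = \<one>"
proof (induction r)
  case (pCons c r)
  have "pCons c r * p = smult c p + pCons 0 (r * p)" by simp
  then show ?case using pCons by (simp add: orb_add orb_smult D_one)
qed simp

lemma orb_uminus: "orb (- p) = inv (orb p)"
  by (rule inv_equality[symmetric]) (simp_all add: orb_add[symmetric])

lemma orb_eq_iff: "orb p = orb q \<longleftrightarrow> orb (p - q) = \<one>"
  by (metis add_diff_cancel_left' diff_add_cancel orb_0 orb_add orb_closed r_cancel_one
      cancel_comm_monoid_add_class.diff_cancel l_one)

lemma orb_X_mult: "orb (polyX * p) = D (orb p)"
  by (simp add: polyX_def D_closed)

lemma orb_of_nat: "orb (of_nat k) = a [^] k"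
  by (simp add: of_nat_poly D_one a_closed int_pow_int)

end

text \<open>The sum \<open>1 + (1 + X) + \<dots> + (1 + X) ^ (2 ^ k - 1)\<close>.\<close>

fun doubling_poly :: "nat \<Rightarrow> int poly" where
  "doubling_poly 0 = 1"
| "doubling_poly (Suc k) = doubling_poly k * (2 + polyX * doubling_poly k)"

text \<open>X times the k-th doubling polynomial is \<open>(1 + X) ^ (2 ^ k) - 1\<close>, which
  Frobenius reduces to \<open>X ^ (2 ^ k)\<close> modulo 2. The induction squares this
  congruence.\<close>

lemma X_power_doubling_poly:
  "2 dvd doubling_poly k * polyX - polyX ^ (2 ^ k)"
proof (induction k)
  case (Suc k)
  let ?X = "polyX :: int poly" and ?q = "doubling_poly k"
  obtain s where s: "?q * ?X - ?X ^ (2 ^ k) = 2 * s" using Suc by blast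
  have identity: "q * (2 + x * q) * x - y * y = 2 * (q * x) + (q * x - y) * (q * x + y)"
    for q x y :: "int poly"
    by (simp add: algebra_simps)
  have "doubling_poly (Suc k) * ?X - ?X ^ (2 ^ Suc k)
      = 2 * (?q * ?X) + (?q * ?X - ?X ^ (2 ^ k)) * (?q * ?X + ?X ^ (2 ^ k))"
    using identity[of ?q ?X "?X ^ (2 ^ k)"]
    by (simp only: doubling_poly.simps power_Suc[of 2] mult_2[of "2 ^ k"] power_add)
  also have "\<dots> = 2 * (?q * ?X + s * (?q * ?X + ?X ^ (2 ^ k)))"
    unfolding s by (simp only: algebra_simps)
  finally show ?case by (rule dvdI)
qed simp

text \<open>The first assumption makes 2 nilpotent modulo the annihilator of \<open>a\<close>;
  together with the second it makes X nilpotent too. Polynomials with odd constant term then become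
  units.\<close>

locale nilpotent_polynomial_orbit = polynomial_orbit G D a for G (structure) and D a +
  fixes n s :: nat
  assumes order_dvd: "card (carrier G) dvd 2 ^ n"
    and orb_doubling_poly: "orb (doubling_poly s) = \<one>"
begin

lemma finite_carrier: "finite (carrier G)"
  using order_dvd by (metis card.infinite dvd_0_left power_not_zero zero_neq_numeral)

lemma orb_mult_eq_one': "orb p = \<one> \<Longrightarrow> orb (p * r) = \<one>"
  using orb_mult_eq_one by (simp add: mult.commute)

lemma orb_add_eq_one: "orb p = \<one> \<Longrightarrow> orb q = \<one> \<Longrightarrow> orb (p + q) = \<one>"
  by (simp add: orb_add)

text \<open>Moves a known congruence into a larger expression; what remains of each later
  calculation is a polynomial identity.\<close>

lemma orb_transfer: "orb x = orb y \<Longrightarrow> p - p' = (x - y) * r \<Longrightarrow> orb p = orb p'"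
  using orb_eq_iff[of x y] orb_eq_iff[of p p'] orb_mult_eq_one' by simp

lemma orb_two_power: "orb (2 ^ n) = \<one>"
proof -
  have "a [^] card (carrier G) = \<one>"
    using pow_order_eq_1[OF a_closed] by (simp add: Coset.order_def)
  then have "a [^] ((2::nat) ^ n) = \<one>"
    using order_dvd by (metis a_closed dvdE nat_pow_one nat_pow_pow)
  then show ?thesis using orb_of_nat[of "2 ^ n"] by simp
qed

text \<open>Since \<open>doubling_poly s\<close> kills \<open>a\<close>, the congruence modulo 2
  makes \<open>X ^ (2 ^ s)\<close> act as a multiple of 2, whose n-th power vanishes.\<close>

lemma orb_polyX_nilpotent: "\<exists>k. orb (polyX ^ k) = \<one>"
proof -
  obtain w where w: "doubling_poly s * polyX - polyX ^ (2 ^ s) = 2 * w"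
    using X_power_doubling_poly by blast
  have "polyX ^ (2 ^ s) - 2 * (- w) = doubling_poly s * polyX"
    using w by (simp add: algebra_simps)
  then have "doubling_poly s dvd (polyX ^ (2 ^ s)) ^ n - (2 * (- w)) ^ n"
    by (metis diff_dvd_power_diff dvd_mult_left)
  then have "orb ((polyX ^ (2 ^ s)) ^ n - (2 * (- w)) ^ n) = \<one>"
    using orb_mult_eq_one'[OF orb_doubling_poly] by (auto elim: dvdE)
  moreover have "orb ((2 * (- w)) ^ n) = \<one>"
    unfolding power_mult_distrib by (rule orb_mult_eq_one'[OF orb_two_power])
  ultimately have "orb ((polyX ^ (2 ^ s)) ^ n) = \<one>"
    using orb_eq_iff by metis
  then show ?thesis by (metis power_mult)
qed

text \<open>Such a \<open>p\<close> lies in the ideal (2, X). A power of it is congruent modulo 2 to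
  a multiple of a vanishing power of X, so it acts as twice something and is nilpotent in
  turn.\<close>

lemma orb_nilpotent:
  assumes "even (poly p 0)"
  shows "\<exists>k. orb (p ^ k) = \<one>"
proof -
  obtain c q where p: "p = pCons c q" by (cases p)
  then obtain d where "c = 2 * d" using assms by auto
  then have p': "p = 2 * [:d:] + polyX * q"
    unfolding p by (simp add: polyX_def numeral_poly)
  \<comment> \<open>From here on \<open>s\<close> is a nilpotency exponent of X and shadows the
    locale parameter.\<close>
  obtain s where nil: "orb (polyX ^ s) = \<one>" using orb_polyX_nilpotent by blast
  have "2 dvd p - polyX * q" unfolding p' by (simp only: add_diff_cancel_right' dvd_triv_left)
  then have "2 dvd p ^ s - (polyX * q) ^ s"
    using diff_dvd_power_diff dvd_trans by blast
  then obtain w where w: "p ^ s - (polyX * q) ^ s = 2 * w" by blast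
  have "orb (p ^ s - 2 * w) = \<one>"
    using orb_mult_eq_one'[OF nil, of "q ^ s"] w by (metis diff_diff_eq2 add_diff_cancel_left' power_mult_distrib)
  moreover have "p ^ s - 2 * w dvd (p ^ s) ^ n - (2 * w) ^ n"
    by (rule diff_dvd_power_diff)
  ultimately have "orb ((p ^ s) ^ n - (2 * w) ^ n) = \<one>"
    by (metis dvdE orb_mult_eq_one')
  moreover have "orb ((2 * w) ^ n) = \<one>"
    using orb_mult_eq_one'[OF orb_two_power] by (simp add: power_mult_distrib)
  ultimately have "orb ((p ^ s) ^ n) = \<one>"
    by (metis orb_eq_iff)
  then show ?thesis by (metis power_mult)
qed

text \<open>\<open>1 - u\<close> is nilpotent on the orbit, so a finite geometric series in it
  inverts \<open>u\<close> modulo the annihilator.\<close>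

lemma orb_unit:
  assumes "odd (poly u 0)"
  obtains v where "\<And>p. orb (p * (u * v)) = orb p"
proof -
  have "even (poly (1 - u) 0)" using assms by simp
  then obtain k where k: "orb ((1 - u) ^ k) = \<one>" using orb_nilpotent by blast
  have "1 - (1 - u) dvd 1 ^ k - (1 - u) ^ k"
    by (rule diff_dvd_power_diff)
  then obtain v where v: "1 - (1 - u) ^ k = u * v"
    by (auto elim: dvdE)
  have "orb (p * (u * v)) = orb p" for p
  proof -
    have "p * (u * v) - p = - p * (1 - u) ^ k"
      unfolding v[symmetric] by (simp add: algebra_simps)
    then show ?thesis using orb_eq_iff orb_mult_eq_one[OF k] by metis
  qed
  then show ?thesis using that by blast
qed

lemma orb_unit_cancel:
  assumes "odd (poly u 0)" "orb (p * u) = \<one>"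
  shows "orb p = \<one>"
  using assms by (metis mult.assoc orb_mult_eq_one' orb_unit)

section \<open>Submodules with at most two generators and their orders\<close>

text \<open>The image under \<open>orb\<close> of the ideal (g, h). Two generators accommodate the
  maximal ideal (2, X) times an element; \<open>h = 0\<close> gives cyclic submodules.\<close>

definition span :: "int poly \<Rightarrow> int poly \<Rightarrow> 'a set" where
  "span g h = {orb (g * r + h * t) | r t. True}"

lemma span_subgroup: "subgroup (span g h) G"
proof (rule subgroupI)
  show "span g h \<subseteq> carrier G" by (auto simp: span_def)
  show "span g h \<noteq> {}" by (auto simp: span_def)
next
  fix x assume "x \<in> span g h"
  then obtain r t where "x = orb (g * r + h * t)" by (auto simp: span_def)
  then have "inv x = orb (g * (- r) + h * (- t))"
    using orb_uminus[of "g * r + h * t"] by (simp add: algebra_simps)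
  then show "inv x \<in> span g h" unfolding span_def by blast
next
  fix x y assume "x \<in> span g h" "y \<in> span g h"
  then obtain r t r' t' where xy: "x = orb (g * r + h * t)" "y = orb (g * r' + h * t')"
    by (auto simp: span_def)
  have "x \<otimes> y = orb (g * (r + r') + h * (t + t'))"
    unfolding xy orb_add[symmetric] by (simp add: algebra_simps)
  then show "x \<otimes> y \<in> span g h" unfolding span_def by blast
qed

lemma span_mono:
  assumes "orb g \<in> span g' h'" "orb h \<in> span g' h'"
  shows "span g h \<subseteq> span g' h'"
proof
  fix x assume "x \<in> span g h"
  then obtain r t where x: "x = orb (g * r + h * t)" by (auto simp: span_def)
  obtain r1 t1 r2 t2 where
    1: "orb (g - (g' * r1 + h' * t1)) = \<one>" and 2: "orb (h - (g' * r2 + h' * t2)) = \<one>"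
    using assms orb_eq_iff by (auto simp: span_def)
  have "g * r + h * t - (g' * (r1 * r + r2 * t) + h' * (t1 * r + t2 * t))
      = (g - (g' * r1 + h' * t1)) * r + (h - (g' * r2 + h' * t2)) * t"
    by (simp add: algebra_simps)
  then have "x = orb (g' * (r1 * r + r2 * t) + h' * (t1 * r + t2 * t))"
    unfolding x orb_eq_iff by (simp add: orb_add_eq_one orb_mult_eq_one'[OF 1] orb_mult_eq_one'[OF 2])
  then show "x \<in> span g' h'" unfolding span_def by blast
qed

lemma gen_in_span: "orb (g * r) \<in> span g h" "orb (h * r) \<in> span g h"
proof -
  show "orb (g * r) \<in> span g h"
    unfolding span_def mem_Collect_eq by (rule exI[of _ r], rule exI[of _ 0]) simp
  show "orb (h * r) \<in> span g h"
    unfolding span_def mem_Collect_eq by (rule exI[of _ 0], rule exI[of _ r]) simp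
qed

lemma gen_in_span': "orb g \<in> span g h" "orb h \<in> span g h"
  using gen_in_span[of g 1 h] gen_in_span[of h 1 g] by simp_all

lemma in_span_single: "x \<in> span g 0 \<longleftrightarrow> (\<exists>r. x = orb (g * r))"
  by (auto simp: span_def)

lemma finite_span: "finite (span g h)"
  using span_subgroup finite_carrier finite_subset subgroup.subset by blast

lemma card_span_pos: "card (span g h) > 0"
  using finite_span gen_in_span' by (metis card_gt_0_iff empty_iff)

text \<open>By Lagrange both orders are powers of 2, so a proper inclusion has index at least
  two.\<close>

lemma card_subgroup_strict:
  assumes H: "subgroup H G" and K: "subgroup K G" and "H \<subset> K"
  shows "2 * card H \<le> card K"
proof -
  have fin: "finite K" using K finite_carrier finite_subset subgroup.subset by blast
  have "\<exists>i. card H = 2 ^ i" if "subgroup H G" for H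
    using lagrange_finite[OF finite_carrier that, unfolded Coset.order_def] order_dvd
      divides_primepow_nat[OF two_is_prime_nat] by (metis dvd_trans dvd_triv_right)
  then obtain i j where ij: "card H = 2 ^ i" "card K = 2 ^ j" using H K by meson
  have "card H < card K" using psubset_card_mono[OF fin assms(3)] .
  then have "i < j" unfolding ij by simp
  then have "(2::nat) ^ Suc i \<le> 2 ^ j" by (intro power_increasing) auto
  then show ?thesis unfolding ij by simp
qed

lemma card_span_strict:
  "span g h \<subset> span g' h' \<Longrightarrow> 2 * card (span g h) \<le> card (span g' h')"
  by (intro card_subgroup_strict span_subgroup)

section \<open>The chain of submodules generated by the doubling polynomials\<close>

abbreviation q :: "nat \<Rightarrow> int poly" where "q \<equiv> doubling_poly"
abbreviation c :: "nat \<Rightarrow> nat" where "c k \<equiv> card (span (q k) 0)"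

text \<open>The factor 1 exhibits \<open>q (Suc k)\<close> in the shape \<open>g * r + h * t\<close>
  used by \<open>span\<close>.\<close>

lemma q_Suc: "q (Suc k) = 2 * q k * 1 + polyX * q k * q k"
  by (simp add: algebra_simps)

lemma poly_q_even: "k > 0 \<Longrightarrow> even (poly (q k) 0)"
  by (cases k) auto

lemma orb_q_mono:
  assumes "orb (q k) = \<one>" "k \<le> l"
  shows "orb (q l) = \<one>"
  using assms(2)
proof (induction l rule: dec_induct)
  case (step l)
  then show ?case unfolding doubling_poly.simps by (intro orb_mult_eq_one')
qed (rule assms(1))

text \<open>Nakayama: if \<open>q k\<close> were in (2, X) times itself, a factor
  \<open>1 - 2 * r - polyX * t\<close> would kill it, and that factor is a unit.\<close>

lemma span_2_X_strict:
  assumes "orb (q k) \<noteq> \<one>"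
  shows "span (2 * q k) (polyX * q k) \<subset> span (q k) 0"
proof -
  have "span (2 * q k) (polyX * q k) \<subseteq> span (q k) 0"
    using gen_in_span(1)[of "q k" _ 0] by (intro span_mono) (metis mult.commute)+
  moreover have "orb (q k) \<notin> span (2 * q k) (polyX * q k)"
  proof
    assume "orb (q k) \<in> span (2 * q k) (polyX * q k)"
    then obtain r t where "orb (q k) = orb (2 * q k * r + polyX * q k * t)" by (auto simp: span_def)
    moreover have "q k * (1 - 2 * r - polyX * t) - 0 = (q k - (2 * q k * r + polyX * q k * t)) * 1"
      by (simp add: algebra_simps)
    ultimately have "orb (q k * (1 - 2 * r - polyX * t)) = orb 0" by (rule orb_transfer)
    then have "orb (q k * (1 - 2 * r - polyX * t)) = \<one>" by (simp only: orb_0)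
    moreover have "odd (poly (1 - 2 * r - polyX * t) 0)" by simp
    ultimately show False using orb_unit_cancel assms by blast
  qed
  ultimately show ?thesis using gen_in_span'(1) by blast
qed

lemma span_q_Suc: "span (q (Suc k)) 0 \<subseteq> span (2 * q k) (polyX * q k)"
proof (rule span_mono)
  show "orb (q (Suc k)) \<in> span (2 * q k) (polyX * q k)"
    unfolding q_Suc span_def by blast
  show "orb 0 \<in> span (2 * q k) (polyX * q k)"
    using gen_in_span(1)[of "2 * q k" 0] by simp
qed

lemma c_step: "orb (q k) \<noteq> \<one> \<Longrightarrow> 2 * c (Suc k) \<le> c k"
  using span_2_X_strict span_q_Suc by (intro card_span_strict) blast

text \<open>The submodule (2, X) \<open>q k\<close> lies between two consecutive members of the
  chain and already has index at least two in the upper one. Below index four it must therefore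
  equal the lower one.\<close>

lemma small_step:
  assumes "orb (q k) \<noteq> \<one>" "c k < 4 * c (Suc k)"
  obtains r t where "orb (2 * q k) = orb (q (Suc k) * r)" "orb (polyX * q k) = orb (q (Suc k) * t)"
proof -
  have "2 * card (span (2 * q k) (polyX * q k)) \<le> c k"
    by (intro card_span_strict span_2_X_strict assms)
  then have "\<not> 2 * c (Suc k) \<le> card (span (2 * q k) (polyX * q k))"
    using assms(2) by linarith
  then have "span (q (Suc k)) 0 = span (2 * q k) (polyX * q k)"
    using card_span_strict span_q_Suc by blast
  then show ?thesis using that gen_in_span' in_span_single by metis
qed

text \<open>Each of the \<open>j\<close> steps down to \<open>q (k + j)\<close> at least halves the
  order, and the last submodule is still nontrivial, hence the exponent
  \<open>Suc j\<close>.\<close>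

lemma c_lower: "orb (q (k + j)) \<noteq> \<one> \<Longrightarrow> 2 ^ Suc j \<le> c k"
proof (induction j arbitrary: k)
  case 0
  have "span 0 0 \<subset> span (q k) 0"
    using 0 gen_in_span'[of "q k" 0] gen_in_span[of "q k" 0 0] by (auto simp: span_def)
  then have "2 * card (span 0 0) \<le> c k" by (rule card_span_strict)
  then show ?case using card_span_pos[of 0 0] by simp
next
  case (Suc j)
  then have "2 ^ Suc j \<le> c (Suc k)" by (metis add_Suc_shift)
  moreover have "orb (q k) \<noteq> \<one>" using Suc.prems orb_q_mono le_add1 by blast
  ultimately show ?case using c_step[of k] by simp
qed

lemma c_0_le: "c 0 \<le> 2 ^ n"
  by (metis card_mono dvd_imp_le finite_carrier order_dvd order_trans
      span_subgroup subgroup.subset pos2 zero_less_power)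

text \<open>One step of size two below the top makes everything underneath additively cyclic.\<close>

lemma X_q_in_2_q:
  assumes "k > 0" "orb (q k) \<noteq> \<one>" "c k < 4 * c (Suc k)"
  obtains t where "orb (polyX * q k) = orb (2 * q k * t)"
proof -
  obtain r where r: "orb (polyX * q k) = orb (q (Suc k) * r)"
    using small_step[OF assms(2,3)] by metis
  \<comment> \<open>Expanding \<open>q (Suc k) * r\<close> gives
    \<open>polyX * q k * (1 - q k * r)\<close> congruent to \<open>2 * q k * r\<close>. As
    \<open>k > 0\<close>, \<open>q k\<close> has even constant term and the bracket is a
    unit.\<close>
  define u where "u = 1 - q k * r"
  have "odd (poly u 0)" using poly_q_even[OF assms(1)] by (simp add: u_def)
  then obtain v where v: "\<And>p. orb (p * (u * v)) = orb p" using orb_unit by blast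
  have "polyX * q k * (u * v) - 2 * q k * (r * v) = (polyX * q k - q (Suc k) * r) * v"
    unfolding q_Suc u_def by (simp add: algebra_simps)
  then have "orb (polyX * q k * (u * v)) = orb (2 * q k * (r * v))"
    by (rule orb_transfer[OF r])
  then show ?thesis by (intro that) (simp only: v)
qed

text \<open>A 2-adic expansion: split off the constant term of the cofactor and replace X by
  \<open>2 * t\<close> in the rest. After \<open>n\<close> rounds the remainder carries
  \<open>2 ^ n\<close> and vanishes.\<close>

lemma additively_cyclic:
  assumes X_p: "orb (polyX * p) = orb (2 * p * t)"
  shows "\<exists>d::int. orb (p * r) = orb (p * of_int d)"
proof -
  have "\<exists>d w. orb (p * r) = orb (p * (of_int d + 2 ^ j * w))" for j
  proof (induction j)
    case 0
    then show ?case by (intro exI[of _ 0] exI[of _ r]) simp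
  next
    case (Suc j)
    then obtain d w where dw: "orb (p * r) = orb (p * (of_int d + 2 ^ j * w))" by blast
    obtain e w' where "w = pCons e w'" by (cases w)
    then have w: "w = of_int e + polyX * w'" by (simp add: pCons_polyX)
    have "p * (of_int d + 2 ^ j * w) - p * (of_int (d + 2 ^ j * e) + 2 ^ Suc j * (t * w'))
        = (polyX * p - 2 * p * t) * (2 ^ j * w')"
      unfolding w by (simp add: algebra_simps)
    then have "orb (p * (of_int d + 2 ^ j * w))
        = orb (p * (of_int (d + 2 ^ j * e) + 2 ^ Suc j * (t * w')))"
      by (rule orb_transfer[OF X_p])
    then have "orb (p * r) = orb (p * (of_int (d + 2 ^ j * e) + 2 ^ Suc j * (t * w')))"
      using dw by (rule HOL.trans[rotated])
    then show ?case by blast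
  qed
  then obtain d w where dw: "orb (p * r) = orb (p * (of_int d + 2 ^ n * w))" by blast
  have "p * (of_int d + 2 ^ n * w) - p * of_int d = (2 ^ n - 0) * (p * w)"
    by (simp add: algebra_simps)
  then have "orb (p * (of_int d + 2 ^ n * w)) = orb (p * of_int d)"
    by (rule orb_transfer[rotated]) (simp only: orb_two_power orb_0)
  then show ?thesis using dw by auto
qed

text \<open>If \<open>2 ^ j\<close> killed \<open>p\<close>, an integer multiple of \<open>p\<close>
  would depend only on the integer modulo \<open>2 ^ j\<close>, leaving at most \<open>2 ^ j\<close>
  elements.\<close>

lemma cyclic_span_order:
  assumes "\<And>r. \<exists>d::int. orb (p * r) = orb (p * of_int d)" and "2 ^ j < card (span p 0)"
  shows "orb (2 ^ j * p) \<noteq> \<one>"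
proof
  assume *: "orb (2 ^ j * p) = \<one>"
  have "span p 0 \<subseteq> (\<lambda>d. orb (p * of_int d)) ` {0..<2 ^ j}"
  proof
    fix x assume "x \<in> span p 0"
    then obtain r where "x = orb (p * r)" using in_span_single by blast
    then obtain d where x: "x = orb (p * of_int d)" using assms(1)[of r] by auto
    define y z where "y = d mod 2 ^ j" and "z = d div 2 ^ j"
    have d: "d = y + 2 ^ j * z" unfolding y_def z_def by simp
    have "p * of_int d - p * of_int y = (2 ^ j * p - 0) * of_int z"
      unfolding d of_int_add of_int_mult of_int_power of_int_numeral by (simp add: algebra_simps)
    then have "orb (p * of_int d) = orb (p * of_int y)"
      by (rule orb_transfer[rotated]) (simp only: * orb_0)
    then have "x = orb (p * of_int (d mod 2 ^ j))"
      unfolding x y_def .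
    then show "x \<in> (\<lambda>d. orb (p * of_int d)) ` {0..<2 ^ j}" by simp
  qed
  then have "card (span p 0) \<le> card {0..<2 ^ j :: int}"
    by (meson card_image_le card_mono finite_atLeastLessThan_int finite_imageI order_trans)
  then show False using assms(2) by (simp add: nat_power_eq)
qed

text \<open>Otherwise the ideals (1), (2, q 1), (4, q 1), (q 1) would form a strictly decreasing
  chain on the orbit, forcing index at least 8.\<close>

lemma four_in_span_q1:
  assumes "orb 1 \<noteq> \<one>" "c 0 < 8 * c 1"
  shows "\<exists>r. orb 4 = orb (q 1 * r)"
proof (rule ccontr)
  assume no: "\<nexists>r. orb 4 = orb (q 1 * r)"
  have "span (q 1) 0 \<subset> span 4 (q 1)"
  proof -
    have "span (q 1) 0 \<subseteq> span 4 (q 1)"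
      using gen_in_span(2)[of "q 1" 0 4] by (intro span_mono gen_in_span') simp
    moreover have "orb 4 \<notin> span (q 1) 0" using no by (auto simp only: in_span_single)
    ultimately show ?thesis using gen_in_span'(1) by blast
  qed
  moreover have "span 4 (q 1) \<subset> span 2 (q 1)"
  proof -
    have "span 4 (q 1) \<subseteq> span 2 (q 1)"
      using gen_in_span(1)[of 2 2 "q 1"] by (intro span_mono gen_in_span') simp
    moreover have "orb 2 \<notin> span 4 (q 1)"
    proof
      assume "orb 2 \<in> span 4 (q 1)"
      then obtain r t where rt: "orb 2 = orb (4 * r + q 1 * t)" unfolding span_def by blast
      \<comment> \<open>The relation says \<open>2 * (1 - 2 * r)\<close> is a multiple of
        \<open>q 1\<close>; doubling it and cancelling the unit puts 4 there.\<close>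
      have "odd (poly (1 - 2 * r) 0)" by simp
      then obtain v where v: "\<And>p. orb (p * ((1 - 2 * r) * v)) = orb p" by (rule orb_unit) blast
      have "4 * ((1 - 2 * r) * v) - q 1 * (2 * t * v) = (2 - (4 * r + q 1 * t)) * (2 * v)"
        by (simp add: algebra_simps)
      then have "orb (4 * ((1 - 2 * r) * v)) = orb (q 1 * (2 * t * v))"
        by (rule orb_transfer[OF rt])
      then show False using no v[of 4] by metis
    qed
    ultimately show ?thesis using gen_in_span'(1) by blast
  qed
  moreover have "span 2 (q 1) \<subset> span (q 0) 0"
  proof -
    have "span 2 (q 1) \<subseteq> span (q 0) 0"
      using gen_in_span(1)[of 1 _ 0] by (intro span_mono) simp_all
    moreover have "orb 1 \<notin> span 2 (q 1)"
    proof
      assume "orb 1 \<in> span 2 (q 1)"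
      then obtain r t where rt: "orb 1 = orb (2 * r + q 1 * t)" unfolding span_def by blast
      have "1 * (1 - 2 * r - q 1 * t) - 0 = (1 - (2 * r + q 1 * t)) * 1" by simp
      then have "orb (1 * (1 - 2 * r - q 1 * t)) = orb 0" by (rule orb_transfer[OF rt])
      moreover have "odd (poly (1 - 2 * r - q 1 * t) 0)" by simp
      ultimately show False using assms(1) orb_unit_cancel orb_0 by metis
    qed
    ultimately show ?thesis using gen_in_span'(1)[of 1 0] by auto
  qed
  ultimately have "2 * c 1 \<le> card (span 4 (q 1))" "2 * card (span 4 (q 1)) \<le> card (span 2 (q 1))"
    "2 * card (span 2 (q 1)) \<le> c 0"
    using card_span_strict by blast+
  then show False using assms(2) by linarith
qed

theorem orb_two_power_neq_one:
  assumes n: "n \<ge> 5" and q_neq: "orb (q (n - 2)) \<noteq> \<one>"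
  shows "orb (2 ^ (n - 2)) \<noteq> \<one>"
proof -
  have neq: "orb (q k) \<noteq> \<one>" if "k \<le> 3" for k
    using q_neq orb_q_mono[of k "n - 2"] that n by linarith
  obtain l where l: "n = l + 5" using n by (metis le_add_diff_inverse2)
  have idx: "3 + l = n - 2" "1 + (l + 2) = n - 2" "0 + (l + 3) = n - 2"
    "Suc l = l + 1" "Suc (l + 2) = l + 3" "Suc (l + 3) = l + 4"
    using l by simp_all
  have "2 ^ (l + 1) \<le> c 3" and c1: "2 ^ (l + 3) \<le> c 1" and c0: "2 ^ (l + 4) \<le> c 0"
    using c_lower[of 3 l] c_lower[of 1 "l + 2"] c_lower[of 0 "l + 3"] q_neq
    by (simp_all only: idx not_False_eq_True simp_thms)
  have "2 * c 1 \<le> c 0" "2 * c 2 \<le> c 1" "2 * c 3 \<le> c 2"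
    using c_step[of 0] c_step[of 1] c_step[of 2] neq
    by (simp_all add: numeral_eq_Suc del: doubling_poly.simps)
  moreover have "c 0 \<le> 16 * c 3"
    using c_0_le \<open>2 ^ (l + 1) \<le> c 3\<close> by (simp add: l power_add)
  moreover have "c 3 > 0" by (rule card_span_pos)
  \<comment> \<open>The three indices are at least 2 with product at most 16. Either the second is
    below 4, and then the first is below 8, or the second is at least 4 and the other two are
    2.\<close>
  ultimately consider (top) "c 1 < 4 * c 2" "c 0 < 8 * c 1" | (jump) "c 0 < 4 * c 1" "c 2 < 4 * c 3"
    by linarith
  then show ?thesis
  proof cases
    case top
    obtain t where "orb (polyX * q 1) = orb (2 * q 1 * t)"
      using X_q_in_2_q[of 1] neq[of 1] top(1) by (metis numeral_2_eq_2 One_nat_def less_numeral_extra(1) one_le_numeral)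
    then have cyclic: "\<exists>d. orb (q 1 * r) = orb (q 1 * of_int d)" for r
      by (rule additively_cyclic)
    have "2 ^ (l + 2) < c 1"
      using c1 power_strict_increasing[of "l + 2" "l + 3" "2::nat"] by linarith
    then have ord: "orb (2 ^ (l + 2) * q 1) \<noteq> \<one>" by (rule cyclic_span_order[OF cyclic])
    have "orb 1 \<noteq> \<one>" using neq[of 0] by simp
    then obtain d where d: "orb 4 = orb (q 1 * of_int d)"
      using four_in_span_q1[OF _ top(2)] cyclic by metis
    have odd_of_int: "odd (poly (of_int f :: int poly) 0)" if "odd f" for f :: int
      using that by (simp add: of_int_poly)
    show ?thesis
    proof
      assume "orb (2 ^ (n - 2)) = \<one>"
      then have zero: "orb (2 ^ (l + 3)) = orb 0" by (simp add: l add.commute)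
      \<comment> \<open>Cases by the 2-adic valuation of \<open>d\<close>. For valuation 0 or 1,
        \<open>4 = q 1 * d\<close> turns the vanishing of \<open>2 ^ (l + 3)\<close> into that of
        \<open>2 ^ (l + 2) * q 1\<close>; otherwise a unit multiple of 4, hence 4 itself,
        vanishes.\<close>
      consider "odd d" | f where "d = 2 * f" "odd f" | g where "d = 4 * g"
        by (metis dvd_def mult.assoc mult_2 numeral_Bit0)
      then show False
      proof cases
        case 1
        have "2 ^ (l + 1) * q 1 * of_int d - 2 ^ (l + 3) = (q 1 * of_int d - 4) * 2 ^ (l + 1)"
          by (simp add: algebra_simps power_add)
        then have "orb (2 ^ (l + 1) * q 1 * of_int d) = orb (2 ^ (l + 3))"
          by (rule orb_transfer[OF d[symmetric]])
        then have "orb (2 ^ (l + 1) * q 1) = \<one>"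
          using zero odd_of_int[OF 1] orb_unit_cancel orb_0 by metis
        then have "orb (2 * (2 ^ (l + 1) * q 1)) = \<one>" by (rule orb_mult_eq_one)
        then show ?thesis using ord by (simp add: mult.assoc)
      next
        case 2
        have "2 ^ (l + 2) * q 1 * of_int f - 2 ^ (l + 3) = (q 1 * of_int d - 4) * 2 ^ (l + 1)"
          by (simp add: algebra_simps power_add 2)
        then have "orb (2 ^ (l + 2) * q 1 * of_int f) = orb (2 ^ (l + 3))"
          by (rule orb_transfer[OF d[symmetric]])
        then show ?thesis
          using zero odd_of_int[OF 2(2)] orb_unit_cancel ord orb_0 by metis
      next
        case 3
        have "4 * (1 - q 1 * of_int g) - 0 = (4 - q 1 * of_int d) * 1"
          by (simp add: algebra_simps 3)
        then have "orb (4 * (1 - q 1 * of_int g)) = orb 0" by (rule orb_transfer[OF d])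
        moreover have "odd (poly (1 - q 1 * of_int g) 0)" using poly_q_even[of 1] by simp
        ultimately have "orb 4 = \<one>" using orb_unit_cancel orb_0 by metis
        then have "orb (2 ^ l * q 1 * 4) = \<one>" by (rule orb_mult_eq_one)
        then show ?thesis using ord by (simp add: power_add mult.commute mult.left_commute)
      qed
    qed
  next
    case jump
    \<comment> \<open>Index two at the top means that \<open>q 1\<close> generates the maximal ideal
      (2, X).\<close>
    obtain r t where r: "orb 2 = orb (q 1 * r)" and t: "orb polyX = orb (q 1 * t)"
      using small_step[of 0] neq[of 0] jump(1) by (metis One_nat_def doubling_poly.simps(1) mult.right_neutral zero_le)
    obtain s where s: "orb (polyX * q 2) = orb (2 * q 2 * s)"
      using X_q_in_2_q[of 2] neq[of 2] jump(2)
      by (metis eval_nat_numeral(3) numeral_le_iff pos2 semiring_norm(68) semiring_norm(72))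
    \<comment> \<open>If \<open>r\<close> is a unit, 2 generates the maximal ideal, X becomes a
      multiple of 2, and the whole orbit is additively cyclic. Otherwise 2 is divisible by the
      square of \<open>q 1\<close>, which will force \<open>q 3\<close> to vanish.\<close>
    show ?thesis
    proof (cases "odd (poly r 0)")
      case True
      then obtain v where v: "\<And>p. orb (p * (r * v)) = orb p" by (rule orb_unit) blast
      have "2 * (v * t) - q 1 * t * (r * v) = (2 - q 1 * r) * (v * t)"
        by (simp add: algebra_simps)
      then have "orb (2 * (v * t)) = orb (q 1 * t * (r * v))" by (rule orb_transfer[OF r])
      then have "orb (polyX * 1) = orb (2 * 1 * (v * t))" using v[of "q 1 * t"] t by simp
      then have "\<exists>d. orb (1 * p) = orb (1 * of_int d)" for p by (rule additively_cyclic)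
      moreover have "2 ^ (l + 3) < card (span 1 0)"
        using c0 power_strict_increasing[of "l + 3" "l + 4" "2::nat"]
        unfolding doubling_poly.simps by linarith
      ultimately have "orb (2 ^ (l + 3) * 1) \<noteq> \<one>" by (rule cyclic_span_order)
      then show ?thesis by (simp add: l add.commute)
    next
      case False
      obtain e r' where "r = pCons e r'" by (cases r)
      \<comment> \<open>An even constant term puts \<open>r\<close> in (2, X), hence among the
        multiples of \<open>q 1\<close>.\<close>
      then obtain d where "r = 2 * of_int d + polyX * r'"
        using False by (auto simp: pCons_polyX elim: evenE)
      then have "r - q 1 * (r * of_int d + t * r') = (2 - q 1 * r) * of_int d + (polyX - q 1 * t) * r'"
        by (simp add: algebra_simps)
      moreover have "orb ((2 - q 1 * r) * of_int d) = \<one>" "orb ((polyX - q 1 * t) * r') = \<one>"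
        using r t by (simp_all add: orb_eq_iff orb_mult_eq_one')
      ultimately have rw: "orb r = orb (q 1 * (r * of_int d + t * r'))"
        unfolding orb_eq_iff[of r] by (simp only: orb_add_eq_one)
      define w where "w = r * of_int d + t * r'"
      have "q 1 * r - q 1 * q 1 * w = (r - q 1 * w) * q 1" by (simp add: algebra_simps)
      then have two: "orb 2 = orb (q 1 * q 1 * w)"
        using orb_transfer[OF rw[folded w_def]] r by metis
      \<comment> \<open>X is \<open>q 1 - 2\<close>, and 2 is congruent to
        \<open>q 1 * q 1 * w\<close>; so X is \<open>q 1\<close> times this unit.\<close>
      define u where "u = 1 - q 1 * w"
      have q1: "q 1 = 2 + polyX" by simp
      have "polyX - q 1 * u = (q 1 * q 1 * w - 2) * 1"
        unfolding u_def q1 by (simp add: algebra_simps)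
      then have X: "orb polyX = orb (q 1 * u)" by (rule orb_transfer[OF two[symmetric]])
      \<comment> \<open>In \<open>s\<close>, the relation \<open>polyX * q 2 = 2 * q 2 * s\<close>
        has \<open>q 1\<close> to the first power on the left but to the second on the right;
        cancelling a unit kills \<open>q 1 * q 2\<close>.\<close>
      have "q 1 * u * q 2 - polyX * q 2 = (q 1 * u - polyX) * q 2"
        "2 * q 2 * s - q 1 * q 1 * w * q 2 * s = (2 - q 1 * q 1 * w) * (q 2 * s)"
        by (simp_all add: algebra_simps)
      then have "orb (q 1 * u * q 2) = orb (q 1 * q 1 * w * q 2 * s)"
        using orb_transfer[OF X[symmetric]] orb_transfer[OF two] s by metis
      moreover have "q 1 * q 2 * (u - q 1 * (w * s)) - 0 = (q 1 * u * q 2 - q 1 * q 1 * w * q 2 * s) * 1"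
        by (simp add: algebra_simps)
      ultimately have "orb (q 1 * q 2 * (u - q 1 * (w * s))) = orb 0" by (rule orb_transfer)
      moreover have "odd (poly (u - q 1 * (w * s)) 0)"
        using poly_q_even[of 1] by (simp add: u_def)
      ultimately have q12: "orb (q 1 * q 2) = orb 0" using orb_unit_cancel orb_0 by metis
      \<comment> \<open>Both 2 and X are multiples of \<open>q 1\<close>, so both annihilate
        \<open>q 2\<close>, and \<open>q 3\<close> lies in (2, X) times \<open>q 2\<close>.\<close>
      have "2 * q 2 - q 1 * q 1 * w * q 2 = (2 - q 1 * q 1 * w) * q 2"
        "q 1 * q 1 * w * q 2 - 0 = (q 1 * q 2 - 0) * (q 1 * w)"
        "polyX * q 2 - q 1 * u * q 2 = (polyX - q 1 * u) * q 2"
        "q 1 * u * q 2 - 0 = (q 1 * q 2 - 0) * u"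
        by (simp_all add: algebra_simps)
      then have "orb (2 * q 2) = orb 0" "orb (polyX * q 2) = orb 0"
        using orb_transfer[OF two] orb_transfer[OF X] orb_transfer[OF q12] by metis+
      then have "orb (2 * q 2 * 1 + polyX * q 2 * q 2) = \<one>"
        using orb_add_eq_one[OF orb_mult_eq_one' orb_mult_eq_one'] by (simp only: orb_0)
      then have "orb (q 3) = \<one>"
        using q_Suc[of 2] by (simp add: numeral_eq_Suc del: doubling_poly.simps)
      then show ?thesis using neq[of 3] by simp
    qed
  qed
qed
end

section \<open>The modular maximal-cyclic group\<close>

text \<open>A faithful action on \<open>\<int>/2 ^ (m + 1)\<close>. The generator \<open>b\<close> acts as an involution, so its sign is ignored.\<close>

fun mmc_act :: "nat \<Rightarrow> mmc_gen \<times> bool \<Rightarrow> int \<Rightarrow> int" where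
  "mmc_act m (Gen_a, s) x = (if s then x + 1 else x - 1) mod 2 ^ Suc m"
| "mmc_act m (Gen_b, s) x = (1 + 2 ^ m) * x mod 2 ^ Suc m"

definition mmc_act_word :: "nat \<Rightarrow> mmc_gen word \<Rightarrow> int \<Rightarrow> int" where
  "mmc_act_word m w = foldr (mmc_act m) w"

lemma mmc_act_word_simps [simp]:
  "mmc_act_word m [] x = x"
  "mmc_act_word m (g # w) x = mmc_act m g (mmc_act_word m w x)"
  "mmc_act_word m (u @ v) x = mmc_act_word m u (mmc_act_word m v x)"
  by (simp_all add: mmc_act_word_def)

lemma mmc_act_range: "mmc_act m g x \<in> {0..<2 ^ Suc m}"
  by (cases g; cases "fst g") (auto simp del: power_Suc)

lemma mmc_act_word_range: "x \<in> {0..<2 ^ Suc m} \<Longrightarrow> mmc_act_word m w x \<in> {0..<2 ^ Suc m}"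
  by (induction w) (simp_all only: mmc_act_word_simps mmc_act_range)

lemma mmc_act_word_replicate_a:
  "x \<in> {0..<2 ^ Suc m} \<Longrightarrow>
    mmc_act_word m (replicate k (Gen_a, True)) x = (x + int k) mod 2 ^ Suc m"
  by (induction k) (simp_all add: mod_simps algebra_simps del: power_Suc)

text \<open>\<open>(1 + 2 ^ m) ^ 2\<close> is \<open>1 + 2 ^ (m + 1) + 2 ^ (2 * m)\<close>, and
  \<open>2 * m\<close> is at least \<open>m + 1\<close>.\<close>

lemma mmc_b_involution:
  assumes "m \<ge> 1"
  shows "(1 + 2 ^ m) * ((1 + 2 ^ m) * x) mod 2 ^ Suc m = (x::int) mod 2 ^ Suc m"
proof -
  obtain k where m: "m = Suc k" using assms by (cases m) auto
  have "(1 + 2 ^ m) * ((1 + 2 ^ m) * x) = x + (x * (1 + 2 ^ k)) * 2 ^ Suc m"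
    unfolding m by (simp add: algebra_simps)
  then show ?thesis by (metis mod_mult_self1)
qed

text \<open>The defining relations hold for the action, so it descends to the presented group and
  can tell its elements apart.\<close>

lemma mmc_act_word_cong:
  assumes "m \<ge> 1" "pres_eq (mmc_rels m) u v" "x \<in> {0..<2 ^ Suc m}"
  shows "mmc_act_word m u x = mmc_act_word m v x"
  using assms(2,3)
proof (induction arbitrary: x)
  case (append u v u' v')
  then show ?case using mmc_act_word_range by (simp only: mmc_act_word_simps)
next
  case (cancel g s)
  then show ?case
    by (cases g) (simp_all add: mod_simps mmc_b_involution[OF assms(1)] del: power_Suc)
next
  case (rel u v)
  note b = mmc_b_involution[OF assms(1)]
  \<comment> \<open>Conjugating translation by 1 with multiplication by \<open>1 + 2 ^ m\<close>
    gives translation by \<open>1 + 2 ^ m\<close>.\<close>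
  have "(1 + 2 ^ m) * ((1 + 2 ^ m) * x + 1) mod 2 ^ Suc m
      = ((1 + 2 ^ m) * ((1 + 2 ^ m) * x) mod 2 ^ Suc m + (1 + 2 ^ m)) mod 2 ^ Suc m"
    by (simp only: mod_simps) (simp only: distrib_left mult_1_right)
  also have "\<dots> = (x + (1 + 2 ^ m)) mod 2 ^ Suc m"
    unfolding b by (simp only: mod_simps)
  finally have bab: "(1 + 2 ^ m) * ((1 + 2 ^ m) * x + 1) mod 2 ^ Suc m
      = (x + (1 + 2 ^ m)) mod 2 ^ Suc m" .
  consider "u = replicate (2 ^ Suc m) (Gen_a, True)" "v = []"
    | "u = replicate 2 (Gen_b, True)" "v = []"
    | "u = [(Gen_b, True), (Gen_a, True), (Gen_b, False)]" "v = replicate (1 + 2 ^ m) (Gen_a, True)"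
    using rel(1) unfolding mmc_rels_def Suc_eq_plus1[symmetric] by blast
  then show ?case
  proof cases
    case 1
    then show ?thesis using rel(2) by (simp add: mmc_act_word_replicate_a del: power_Suc replicate_Suc)
  next
    case 2
    then show ?thesis using rel(2) b[of x] by (simp add: numeral_2_eq_2 mod_simps del: power_Suc)
  next
    case 3
    have "mmc_act_word m u x = (1 + 2 ^ m) * ((1 + 2 ^ m) * x + 1) mod 2 ^ Suc m"
      unfolding 3 by (simp add: mod_simps del: power_Suc)
    then show ?thesis
      unfolding bab 3(2) mmc_act_word_replicate_a[OF rel(2)] by simp
  qed
qed simp_all

section \<open>Order of the generator a, normal forms and a bound on the group order\<close>

abbreviation mmc_class :: "nat \<Rightarrow> mmc_gen word \<Rightarrow> mmc_gen word set" where
  "mmc_class m w \<equiv> pres_rel (mmc_rels m) `` {w}"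

lemma mmc_class_eq_iff: "mmc_class m u = mmc_class m v \<longleftrightarrow> pres_eq (mmc_rels m) u v"
  using eq_equiv_class_iff[OF equiv_pres_rel] by (simp add: pres_rel_def)

lemma mmc_class_mult: "mmc_class m u \<otimes>\<^bsub>mmc_group m\<^esub> mmc_class m v = mmc_class m (u @ v)"
  unfolding mmc_group_def by (rule presented_group_mult)

lemma mmc_class_closed: "mmc_class m w \<in> carrier (mmc_group m)"
  by (simp add: mmc_group_def presented_group_def quotientI)

lemma mmc_group_one: "\<one>\<^bsub>mmc_group m\<^esub> = mmc_class m []"
  by (simp add: mmc_group_def presented_group_def)

lemma mmc_class_pow:
  "mmc_class m [g] [^]\<^bsub>mmc_group m\<^esub> (k::nat) = mmc_class m (replicate k g)"
proof (induction k)
  case 0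
  then show ?case by (simp add: mmc_group_one)
next
  case (Suc k)
  then show ?case by (simp add: nat_pow_def mmc_class_mult flip: replicate_append_same)
qed

lemma mmc_a_pow:
  "mmc_class m [(Gen_a, True)] [^]\<^bsub>mmc_group m\<^esub> (2 ^ Suc m :: nat) = \<one>\<^bsub>mmc_group m\<^esub>"
proof -
  have "pres_eq (mmc_rels m) (replicate (2 ^ Suc m) (Gen_a, True)) []"
    by (rule pres_eq.rel) (simp add: mmc_rels_def)
  then show ?thesis
    unfolding mmc_class_pow mmc_group_one mmc_class_eq_iff .
qed

text \<open>In the action this power moves 0 to \<open>2 ^ m\<close>, which is nonzero modulo
  \<open>2 ^ (m + 1)\<close>.\<close>

lemma mmc_a_pow_neq:
  assumes "m \<ge> 1"
  shows "mmc_class m [(Gen_a, True)] [^]\<^bsub>mmc_group m\<^esub> (2 ^ m :: nat) \<noteq> \<one>\<^bsub>mmc_group m\<^esub>"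
proof
  assume "mmc_class m [(Gen_a, True)] [^]\<^bsub>mmc_group m\<^esub> (2 ^ m :: nat) = \<one>\<^bsub>mmc_group m\<^esub>"
  then have "pres_eq (mmc_rels m) (replicate (2 ^ m) (Gen_a, True)) []"
    unfolding mmc_class_pow mmc_group_one mmc_class_eq_iff .
  then have "mmc_act_word m (replicate (2 ^ m) (Gen_a, True)) 0 = 0"
    using mmc_act_word_cong[OF assms] by fastforce
  then show False by (simp add: mmc_act_word_replicate_a)
qed

text \<open>Inverses are replaced by positive powers, each b moves right past the a's while
  multiplying their exponent by \<open>1 + 2 ^ m\<close>, and exponents are finally reduced.\<close>

lemma mmc_normal_form:
  "\<exists>i j. i < 2 ^ Suc m \<and> j < 2 \<and>
     pres_eq (mmc_rels m) w (replicate i (Gen_a, True) @ replicate j (Gen_b, True))"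
proof -
  let ?eq = "pres_eq (mmc_rels m)" and ?a = "\<lambda>i. replicate i (Gen_a, True)"
    and ?b = "\<lambda>j. replicate j (Gen_b, True)"
  note [trans] = pres_eq.trans
  have left: "?eq (u @ v) (u' @ v)" if "?eq u u'" for u u' v
    using that pres_eq.append pres_eq.refl by blast
  have right: "?eq (u @ v) (u @ v')" if "?eq v v'" for u v v'
    using that pres_eq.append pres_eq.refl by blast
  have aN: "?eq (?a (2 ^ Suc m)) []" and bb: "?eq (?b 2) []"
    and bab: "?eq [(Gen_b, True), (Gen_a, True), (Gen_b, False)] (?a (1 + 2 ^ m))"
    by (auto intro: pres_eq.rel simp: mmc_rels_def)
  have reduce: "?eq (?a i) (?a (i mod 2 ^ Suc m))" for i
  proof (induction i rule: less_induct)
    case (less i)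
    show ?case
    proof (cases "i < 2 ^ Suc m")
      case False
      then have i: "i = 2 ^ Suc m + (i - 2 ^ Suc m)" by simp
      have "?eq (?a i) ([] @ ?a (i - 2 ^ Suc m))"
        by (subst i, subst replicate_add) (rule left[OF aN])
      also have "?eq \<dots> (?a (i mod 2 ^ Suc m))"
        using less[of "i - 2 ^ Suc m"] False
        by (simp add: le_mod_geq order_less_le_trans[of 0 "2 * 2 ^ m" i])
      finally show ?thesis .
    qed (simp add: pres_eq.refl)
  qed
  have ba: "?eq ((Gen_b, True) # ?a i) (?a ((1 + 2 ^ m) * i) @ [(Gen_b, True)])" for i
  proof (induction i)
    case 0
    show ?case by (simp add: pres_eq.refl)
  next
    case (Suc i)
    \<comment> \<open>Inserting the inverse of b followed by b after the first a exposes the left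
      side of the conjugation relation.\<close>
    have "?eq ([(Gen_b, True), (Gen_a, True)] @ [] @ ?a i)
        ([(Gen_b, True), (Gen_a, True)] @ [(Gen_b, False), (Gen_b, True)] @ ?a i)"
      using pres_eq.sym[OF pres_eq.cancel[of _ Gen_b False]] by (intro right left) simp
    also have "?eq ([(Gen_b, True), (Gen_a, True)] @ [(Gen_b, False), (Gen_b, True)] @ ?a i)
        (?a (1 + 2 ^ m) @ (Gen_b, True) # ?a i)"
      using left[OF bab, of "(Gen_b, True) # ?a i"] by simp
    also have "?eq \<dots> (?a (1 + 2 ^ m) @ ?a ((1 + 2 ^ m) * i) @ [(Gen_b, True)])"
      by (rule right[OF Suc.IH])
    finally show ?case by (simp add: replicate_add flip: append_assoc)
  qed
  have b_inv: "?eq [(Gen_b, False)] [(Gen_b, True)]"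
  proof -
    have "?eq ([(Gen_b, False)] @ []) ([(Gen_b, False)] @ ?b 2)"
      by (rule right[OF pres_eq.sym[OF bb]])
    also have "?eq \<dots> ([] @ [(Gen_b, True)])"
      using left[OF pres_eq.cancel[of _ Gen_b False], of "[(Gen_b, True)]"] by (simp add: numeral_2_eq_2)
    finally show ?thesis by simp
  qed
  obtain N where N: "(2::nat) ^ Suc m = Suc N"
    using gr0_conv_Suc[of "2 ^ Suc m"] by auto
  have a_inv: "?eq [(Gen_a, False)] (?a N)"
  proof -
    have "?eq ([(Gen_a, False)] @ []) ([(Gen_a, False)] @ ?a (Suc N))"
      using right[OF pres_eq.sym[OF aN]] unfolding N .
    also have "?eq \<dots> ([] @ ?a N)"
      using left[OF pres_eq.cancel[of _ Gen_a False], of "?a N"] by simp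
    finally show ?thesis by simp
  qed
  have "\<exists>i j. ?eq w (?a i @ ?b j)"
  proof (induction w)
    case Nil
    show ?case by (intro exI[of _ 0]) (simp add: pres_eq.refl)
  next
    case (Cons x w)
    then obtain i j where ij: "?eq w (?a i @ ?b j)" by blast
    have a: "\<exists>i' j'. ?eq (?a k @ w) (?a i' @ ?b j')" for k
      using right[OF ij, of "?a k"] by (metis append.assoc replicate_add)
    have b: "\<exists>i' j'. ?eq ([(Gen_b, True)] @ w) (?a i' @ ?b j')"
    proof -
      have "?eq ([(Gen_b, True)] @ w) ([(Gen_b, True)] @ (?a i @ ?b j))"
        by (rule right[OF ij])
      also have "?eq \<dots> ((?a ((1 + 2 ^ m) * i) @ [(Gen_b, True)]) @ ?b j)"
        using left[OF ba] by simp
      finally have "?eq ([(Gen_b, True)] @ w) (?a ((1 + 2 ^ m) * i) @ ?b (Suc j))" by simp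
      then show ?thesis by blast
    qed
    obtain g s where x: "x = (g, s)" by (cases x)
    have "\<exists>u. ?eq [x] u \<and> (\<exists>i' j'. ?eq (u @ w) (?a i' @ ?b j'))"
    proof (cases g)
      case Gen_a
      show ?thesis
      proof (cases s)
        case True
        then show ?thesis using a[of 1] Gen_a x pres_eq.refl by (intro exI[of _ "[x]"]) auto
      next
        case False
        then show ?thesis using a a_inv Gen_a x by auto
      qed
    next
      case Gen_b
      then have "?eq [x] [(Gen_b, True)]" using b_inv x pres_eq.refl by (cases s) auto
      then show ?thesis using b by blast
    qed
    then show ?case using left pres_eq.trans by (metis append_Cons append_Nil)
  qed
  then obtain i j where ij: "?eq w (?a i @ ?b j)" by blast
  have "?eq (?b j) (?b (j mod 2))"
  proof (induction j rule: less_induct)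
    case (less j)
    show ?case
    proof (cases "j < 2")
      case False
      then have j: "j = 2 + (j - 2)" by simp
      have "?eq (?b j) ([] @ ?b (j - 2))"
        by (subst j, subst replicate_add) (rule left[OF bb])
      also have "?eq \<dots> (?b (j mod 2))"
        using less[of "j - 2"] False by (simp add: le_mod_geq)
      finally show ?thesis .
    qed (simp add: pres_eq.refl)
  qed
  then have "?eq w (?a (i mod 2 ^ Suc m) @ ?b (j mod 2))"
    using ij reduce pres_eq.append pres_eq.trans by blast
  then show ?thesis by (intro exI[of _ "i mod 2 ^ Suc m"] exI[of _ "j mod 2"]) simp
qed

lemma mmc_group_card:
  "finite (carrier (mmc_group m)) \<and> card (carrier (mmc_group m)) \<le> 2 ^ (m + 2)"
proof -
  let ?f = "\<lambda>(i, j). mmc_class m (replicate i (Gen_a, True) @ replicate j (Gen_b, True))"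
  let ?S = "{..<2 ^ Suc m} \<times> {..<2} :: (nat \<times> nat) set"
  have sub: "carrier (mmc_group m) \<subseteq> ?f ` ?S"
  proof
    fix Y assume "Y \<in> carrier (mmc_group m)"
    then obtain w where w: "Y = mmc_class m w"
      by (auto simp: mmc_group_def presented_group_def elim: quotientE)
    obtain i j where "i < 2 ^ Suc m" "j < 2"
      "pres_eq (mmc_rels m) w (replicate i (Gen_a, True) @ replicate j (Gen_b, True))"
      using mmc_normal_form by blast
    then have "Y = ?f (i, j)" "(i, j) \<in> ?S" unfolding w by (simp_all add: mmc_class_eq_iff)
    then show "Y \<in> ?f ` ?S" by blast
  qed
  have fin: "finite (?f ` ?S)" by simp
  have "card (?f ` ?S) \<le> card ?S" by (rule card_image_le) simp
  moreover have "card ?S = 2 ^ (m + 2)" by (simp add: card_cartesian_product)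
  ultimately have "card (carrier (mmc_group m)) \<le> 2 ^ (m + 2)"
    using card_mono[OF fin sub] by linarith
  then show ?thesis using finite_subset[OF sub fin] by blast
qed

section \<open>Groups with a cyclic subgroup of index two\<close>

lemma (in group) ord_eq_two_power:
  assumes "x \<in> carrier G" "x [^] (2 ^ Suc k :: nat) = \<one>" "x [^] (2 ^ k :: nat) \<noteq> \<one>"
  shows "ord x = 2 ^ Suc k"
proof -
  have "ord x dvd 2 ^ Suc k" using assms(1,2) pow_eq_id by blast
  then obtain i where i: "i \<le> Suc k" "ord x = 2 ^ i"
    using divides_primepow_nat[OF two_is_prime_nat] by blast
  have "\<not> ord x dvd 2 ^ k" using assms(1,3) pow_eq_id by blast
  then have "\<not> i \<le> k" unfolding i(2) using le_imp_power_dvd by blast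
  then show ?thesis using i by (simp add: le_Suc_eq)
qed

lemma (in group) cyclic_group_if_ord_eq_order:
  assumes "finite (carrier G)" "x \<in> carrier G" "ord x = card (carrier G)"
  shows "cyclic_group G"
proof -
  have "generate G {x} \<subseteq> carrier G" using assms(2) by (simp add: generate_incl)
  then have "generate G {x} = carrier G"
    using card_subset_eq[OF assms(1)] generate_pow_card[OF assms(2)] assms(3) by simp
  then have "carrier G = range (\<lambda>k::int. x [^] k)"
    using generate_pow[OF assms(2)] by (simp add: full_SetCompr_eq)
  then show ?thesis using cyclic_group assms(2) by blast
qed

context comm_group
begin

lemma int_pow_mod_eq:
  assumes "x \<in> carrier G" "x [^] (int k) = \<one>"
  shows "x [^] (j mod int k) = x [^] j"
proof -
  have "j - j mod int k = int k * (j div int k)" by (simp add: minus_mod_eq_mult_div)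
  then have "int (ord x) dvd j - j mod int k"
    using assms int_pow_eq_id by fastforce
  then show ?thesis using int_pow_eq[OF assms(1)] by blast
qed

text \<open>The subgroup generated by \<open>x\<close> and its coset through \<open>w\<close> are
  disjoint and exhaust the group by counting. \<open>w\<close> stays arbitrary because two different
  representatives are used later.\<close>

lemma index_two_bij:
  assumes fin: "finite (carrier G)" and x: "x \<in> carrier G"
    and card: "card (carrier G) = 2 * ord x"
    and w: "w \<in> carrier G" "w \<notin> range (\<lambda>k::int. x [^] k)"
  shows "bij_betw (\<lambda>(i, j). w [^] i \<otimes> x [^] j) ({0..<2::int} \<times> {0..<int (ord x)}) (carrier G)"
    (is "bij_betw ?f ?S _")
proof -
  have no_coset: "w [^] (1::int) \<otimes> x [^] j \<noteq> w [^] (0::int) \<otimes> x [^] j'" for j j' :: int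
  proof
    assume "w [^] (1::int) \<otimes> x [^] j = w [^] (0::int) \<otimes> x [^] j'"
    then have "w = x [^] j' \<otimes> inv (x [^] j)"
      using w(1) x inv_solve_right by simp
    then have "w = x [^] (j' - j)" using x by (simp add: int_pow_diff)
    then show False using w(2) by blast
  qed
  have inj: "inj_on ?f ?S"
  proof (rule inj_onI, clarify)
    fix i j i' j' :: int
    assume ij: "i \<in> {0..<2}" "i' \<in> {0..<2}" "j \<in> {0..<int (ord x)}" "j' \<in> {0..<int (ord x)}"
      and eq: "w [^] i \<otimes> x [^] j = w [^] i' \<otimes> x [^] j'"
    have "i = 0 \<or> i = 1" "i' = 0 \<or> i' = 1" using ij by auto
    then have i: "i = i'" using eq no_coset by metis
    then have "x [^] j = x [^] j'" using eq w(1) x by simp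
    then have "int (ord x) dvd j' - j" using int_pow_eq[OF x] by blast
    then have "j = j'"
      using ij by (metis atLeastLessThan_iff mod_eq_dvd_iff mod_pos_pos_trivial)
    then show "i = i' \<and> j = j'" using i by simp
  qed
  moreover have "?f ` ?S \<subseteq> carrier G" using w x by auto
  moreover have "card (?f ` ?S) = card (carrier G)"
    using card_image[OF inj] card by (simp add: card_cartesian_product)
  ultimately show ?thesis
    unfolding bij_betw_def using card_subset_eq[OF fin] by blast
qed

text \<open>The subgroup generated by \<open>x\<close> needs a complement of order two: any
  \<open>y\<close> outside it has an even power of \<open>x\<close> as its square, and dividing
  \<open>y\<close> by half that power yields an involution \<open>z\<close>.\<close>

lemma iso_Z2_times_cyclic:
  assumes fin: "finite (carrier G)" and x: "x \<in> carrier G" "ord x = 2 ^ k"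
    and card: "card (carrier G) = 2 * 2 ^ k" and not_cyclic: "\<not> cyclic_group G"
  shows "G \<cong> integer_mod_group 2 \<times>\<times> integer_mod_group (2 ^ k)"
proof -
  let ?H = "range (\<lambda>k::int. x [^] k)"
  note bij = index_two_bij[OF fin x(1), unfolded x(2), OF card]
  have H_closed: "?H \<subseteq> carrier G" using x by auto
  have "carrier G \<noteq> ?H" using not_cyclic cyclic_group x(1) by blast
  then obtain y where y: "y \<in> carrier G" "y \<notin> ?H" using H_closed by blast
  have rep: "\<exists>i\<in>{0, 1}. \<exists>j. g = y [^] (i::int) \<otimes> x [^] (j::int)" if g: "g \<in> carrier G" for g
  proof -
    have "g \<in> (\<lambda>(i, j). y [^] i \<otimes> x [^] j) ` ({0..<2::int} \<times> {0..<int (2 ^ k)})"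
      unfolding bij_betw_imp_surj_on[OF bij[OF y]] by (rule g)
    then obtain p where p: "p \<in> {0..<2::int} \<times> {0..<int (2 ^ k)}" "g = (case p of (i, j) \<Rightarrow> y [^] i \<otimes> x [^] j)"
      by (rule imageE)
    obtain i j where "p = (i, j)" by (cases p)
    then have "i \<in> {0..<2}" "g = y [^] i \<otimes> x [^] j" using p by simp_all
    moreover from this have "i \<in> {0, 1}" by auto
    ultimately show ?thesis by blast
  qed
  obtain j :: int where j: "y [^] (2::int) = x [^] j"
  proof -
    obtain i j :: int where ij: "i \<in> {0, 1}" "y [^] (2::int) = y [^] i \<otimes> x [^] j"
      using rep[OF int_pow_closed[OF y(1)], of 2] by blast
    \<comment> \<open>A square of \<open>y\<close> in its own coset would put \<open>y\<close> into
      the subgroup.\<close>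
    have "i \<noteq> 1"
    proof
      assume "i = 1"
      then have "y \<otimes> y = y \<otimes> x [^] j"
        using ij(2) y(1) int_pow_mult[OF y(1), of 1 1] by simp
      then show False using y x(1) by auto
    qed
    then show thesis using that ij x(1) by auto
  qed
  have "even j"
  proof (rule ccontr)
    assume "odd j"
    then have "coprime j (2 ^ k)" by simp
    \<comment> \<open>\<open>u\<close> inverts \<open>j\<close> modulo the order of
      \<open>x\<close>, so \<open>x\<close> is a power of \<open>y\<close> and \<open>y\<close>
      would generate the group.\<close>
    then obtain u v where uv: "u * j + v * 2 ^ k = 1" using bezout_int[of j "2 ^ k"] by auto
    have "x = x [^] (u * j + v * 2 ^ k)" using x uv by simp
    also have "\<dots> = x [^] (j * u)"
      using int_pow_eq[OF x(1), of "u * j + v * 2 ^ k" "j * u"] x(2) by (simp add: mult.commute)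
    also have "\<dots> = y [^] (2 * u)"
      using x(1) y(1) j by (simp flip: int_pow_pow)
    finally have xy: "x = y [^] (2 * u)" .
    have "g \<in> range (\<lambda>k::int. y [^] k)" if g: "g \<in> carrier G" for g
    proof -
      obtain i l :: int where "g = y [^] i \<otimes> x [^] l" using rep[OF g] by blast
      then have "g = y [^] (i + 2 * u * l)"
        using xy y(1) by (simp add: int_pow_mult int_pow_pow)
      then show ?thesis by blast
    qed
    then have "carrier G = range (\<lambda>k::int. y [^] k)" using y(1) by auto
    then show False using not_cyclic cyclic_group y(1) by blast
  qed
  then obtain l where l: "j = 2 * l" by blast
  define z where "z = y \<otimes> x [^] (- l)"
  have z: "z \<in> carrier G" using x y by (simp add: z_def)
  have "z [^] (2::int) = \<one>"
    using x(1) y(1) j by (simp add: z_def l int_pow_distrib int_pow_pow flip: int_pow_mult)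
  have "z \<notin> ?H"
  proof
    assume "z \<in> ?H"
    then obtain i :: int where "y \<otimes> x [^] (- l) = x [^] i" by (auto simp: z_def)
    then have "y = x [^] i \<otimes> inv (x [^] (- l))" using x(1) y(1) inv_solve_right by simp
    then have "y = x [^] (i - (- l))" using x(1) by (simp only: int_pow_diff)
    then show False using y(2) by blast
  qed
  let ?f = "\<lambda>(i, j). z [^] (i::int) \<otimes> x [^] (j::int)"
  let ?P = "integer_mod_group 2 \<times>\<times> integer_mod_group (2 ^ k)"
  have carrier_P: "carrier ?P = {0..<2} \<times> {0..<2 ^ k}"
    by (simp add: DirProd_def carrier_integer_mod_group)
  have x_pow: "x [^] (int (2 ^ k)) = \<one>" using x int_pow_eq_id by simp
  have "?f \<in> hom ?P G"
  proof (rule homI)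
    fix g h assume "g \<in> carrier ?P" "h \<in> carrier ?P"
    obtain i j i' j' where gh: "g = (i, j)" "h = (i', j')" by (cases g; cases h)
    have "?f (g \<otimes>\<^bsub>?P\<^esub> h) = z [^] ((i + i') mod int 2) \<otimes> x [^] ((j + j') mod int (2 ^ k))"
      by (simp add: gh DirProd_def)
    also have "\<dots> = z [^] (i + i') \<otimes> x [^] (j + j')"
      using int_pow_mod_eq[OF z, of 2] int_pow_mod_eq[OF x(1) x_pow] \<open>z [^] 2 = \<one>\<close> by simp
    also have "\<dots> = ?f g \<otimes> ?f h"
      using z x(1) by (simp add: gh int_pow_mult m_ac)
    finally show "?f (g \<otimes>\<^bsub>?P\<^esub> h) = ?f g \<otimes> ?f h" .
  qed (use z x in auto)
  moreover have "bij_betw ?f (carrier ?P) (carrier G)"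
    unfolding carrier_P using bij[OF z \<open>z \<notin> ?H\<close>] by simp
  ultimately have "?f \<in> iso ?P G" by (simp add: iso_def)
  then have "?P \<cong> G" by (rule is_isoI)
  moreover have "group ?P" by (simp add: DirProd_group)
  ultimately show ?thesis using group.iso_sym by blast
qed

end

section \<open>Braces\<close>

context brace
begin

text \<open>The lambda map of a right brace: the action of the adjoint group on the additive
  group.\<close>

definition lam :: "'a \<Rightarrow> 'a \<Rightarrow> 'a" where
  "lam b x = x \<otimes> b \<ominus> b"

lemma lam_closed [simp, intro]:
  "b \<in> carrier A \<Longrightarrow> x \<in> carrier A \<Longrightarrow> lam b x \<in> carrier A"
  by (simp add: lam_def)

lemma mult_eq_lam: "b \<in> carrier A \<Longrightarrow> x \<in> carrier A \<Longrightarrow> x \<otimes> b = lam b x \<oplus> b"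
  by (simp add: lam_def a_minus_def a_assoc l_neg)

lemma lam_add:
  assumes "b \<in> carrier A" "x \<in> carrier A" "y \<in> carrier A"
  shows "lam b (x \<oplus> y) = lam b x \<oplus> lam b y"
proof -
  have "(x \<oplus> y) \<otimes> b \<oplus> b = (lam b x \<oplus> b) \<oplus> (lam b y \<oplus> b)"
    using assms by (simp add: brace_law flip: mult_eq_lam)
  then have "lam b (x \<oplus> y) \<oplus> (b \<oplus> b) = (lam b x \<oplus> lam b y) \<oplus> (b \<oplus> b)"
    using assms by (simp add: mult_eq_lam a_ac)
  then show ?thesis using assms by simp
qed

text \<open>Additivity makes \<open>lam \<one>\<close> fix zero, so
  \<open>\<zero> \<otimes> \<one>\<close> equals both \<open>\<zero>\<close> and
  \<open>\<zero> \<oplus> \<one>\<close>.\<close>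

lemma zero_eq_one: "\<zero> = \<one>"
proof -
  have "lam \<one> \<zero> \<oplus> \<zero> = lam \<one> \<zero> \<oplus> lam \<one> \<zero>" using lam_add[of \<one> \<zero> \<zero>] by simp
  then have "lam \<one> \<zero> = \<zero>" by (metis a_assoc a_inv_closed lam_closed one_closed r_neg r_zero zero_closed)
  then show ?thesis using mult_eq_lam[of \<one> \<zero>] by simp
qed

lemma lam_mult:
  assumes "b \<in> carrier A" "d \<in> carrier A" "x \<in> carrier A"
  shows "lam (b \<otimes> d) x = lam d (lam b x)"
proof -
  have "lam (b \<otimes> d) x \<oplus> b \<otimes> d = (x \<otimes> b) \<otimes> d"
    using assms by (simp add: m_assoc flip: mult_eq_lam)
  also have "\<dots> = (lam d (lam b x) \<oplus> lam d b) \<oplus> d"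
    using assms by (simp add: mult_eq_lam lam_add)
  also have "\<dots> = lam d (lam b x) \<oplus> b \<otimes> d"
    using assms by (simp add: mult_eq_lam a_assoc)
  finally show ?thesis using assms by simp
qed

text \<open>Subtracting the identity makes \<open>1 + polyX\<close> act as
  \<open>lam a\<close>.\<close>

lemma lam_orbit:
  assumes a: "a \<in> carrier A"
  shows "polynomial_orbit (add_monoid A) (\<lambda>x. lam a x \<ominus> x) a"
proof -
  have "(\<lambda>x. lam a x \<ominus> x) \<in> hom (add_monoid A) (add_monoid A)"
    using a by (auto simp: hom_def lam_add a_minus_def minus_add a_ac)
  then show ?thesis
    using a a_comm_group by (simp add: polynomial_orbit_def polynomial_orbit_axioms_def)
qed

text \<open>A joint induction: for \<open>b\<close> the current power,
  \<open>b \<otimes> b = lam b b \<oplus> b\<close>, so squaring needs the action of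
  \<open>b\<close> as well as its value. The recursion of \<open>doubling_poly\<close> comes from
  \<open>(1 + X * q) * q + q\<close>, and \<open>(1 + X * q) ^ 2\<close> updates the action.\<close>

lemma pow_two_power_eq_orb:
  assumes a: "a \<in> carrier A"
  defines "orb \<equiv> polynomial_orbit.orb (add_monoid A) (\<lambda>x. lam a x \<ominus> x) a"
  shows "a [^] ((2::nat) ^ k) = orb (doubling_poly k) \<and>
    (\<forall>p. lam (a [^] ((2::nat) ^ k)) (orb p) = orb ((1 + polyX * doubling_poly k) * p))"
proof -
  interpret orbit: polynomial_orbit "add_monoid A" "\<lambda>x. lam a x \<ominus> x" a
    by (rule lam_orbit[OF a])
  note orb_def [simp]
  have closed: "orb p \<in> carrier A" for p using orbit.orb_closed by simp
  have add: "orb (p + q) = orb p \<oplus> orb q" for p q using orbit.orb_add by simp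
  show ?thesis
  proof (induction k)
    case 0
    have "orb 1 = a" using orbit.orb_of_nat[of 1] a by simp
    moreover have "lam a (orb p) = orb ((1 + polyX) * p)" for p
    proof -
      have "orb ((1 + polyX) * p) = orb p \<oplus> (lam a (orb p) \<ominus> orb p)"
        unfolding distrib_right mult_1 add using orbit.orb_X_mult by simp
      also have "\<dots> = lam a (orb p)"
        using a closed[of p] a_lcomm[of "orb p" "lam a (orb p)" "\<ominus> orb p"]
        by (simp add: a_minus_def r_neg del: orb_def)
      finally show ?thesis by simp
    qed
    ultimately show ?case using a by simp
  next
    case (Suc k)
    define b where "b = a [^] ((2::nat) ^ k)"
    have b: "b \<in> carrier A" using a by (simp add: b_def)
    have bb: "a [^] ((2::nat) ^ Suc k) = b \<otimes> b"
      unfolding b_def using a by (simp add: nat_pow_mult mult_2)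
    have IH: "b = orb (doubling_poly k)" "\<And>p. lam b (orb p) = orb ((1 + polyX * doubling_poly k) * p)"
      using Suc unfolding b_def by blast+
    have "b \<otimes> b = lam b b \<oplus> b" by (rule mult_eq_lam[OF b b])
    also have "\<dots> = orb ((1 + polyX * doubling_poly k) * doubling_poly k) \<oplus> orb (doubling_poly k)"
      using IH by metis
    also have "\<dots> = orb (doubling_poly (Suc k))"
      unfolding add[symmetric] by (simp add: algebra_simps del: orb_def)
    finally have 1: "b \<otimes> b = orb (doubling_poly (Suc k))" .
    have "lam (b \<otimes> b) (orb p) = orb ((1 + polyX * doubling_poly (Suc k)) * p)" for p
    proof -
      have "(1 + polyX * doubling_poly k) * ((1 + polyX * doubling_poly k) * p)
          = (1 + polyX * doubling_poly (Suc k)) * p" by (simp add: algebra_simps)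
      then show ?thesis unfolding lam_mult[OF b b closed] IH(2) by (simp only:)
    qed
    then show ?case unfolding bb using 1 by blast
  qed
qed

end

section \<open>Passing from the adjoint group to the additive group\<close>

lemma mmc_brace_element:
  assumes "mmc_brace m A" "m \<ge> 1"
  shows "finite (carrier A)" "card (carrier A) \<le> 2 ^ (m + 2)"
    "\<exists>a\<in>carrier A. a [^]\<^bsub>A\<^esub> ((2::nat) ^ Suc m) = \<one>\<^bsub>A\<^esub> \<and> a [^]\<^bsub>A\<^esub> ((2::nat) ^ m) \<noteq> \<one>\<^bsub>A\<^esub>"
proof -
  interpret mmc_brace m A by fact
  have M: "group (mmc_group m)" unfolding mmc_group_def by (rule group_presented_group)
  obtain h where h: "h \<in> iso (mmc_group m) A"
    using iso_sym[OF adjoint_iso] by (auto simp: is_iso_def)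
  then have hom: "h \<in> hom (mmc_group m) A" and bij: "bij_betw h (carrier (mmc_group m)) (carrier A)"
    by (auto simp: iso_def)
  show "finite (carrier A)" "card (carrier A) \<le> 2 ^ (m + 2)"
    using mmc_group_card bij_betw_finite[OF bij] bij_betw_same_card[OF bij] by metis+
  define x where "x = mmc_class m [(Gen_a, True)]"
  have x: "x \<in> carrier (mmc_group m)" by (simp add: x_def mmc_class_closed)
  have pow: "h x [^]\<^bsub>A\<^esub> (k::nat) = h (x [^]\<^bsub>mmc_group m\<^esub> k)" for k
    using hom_nat_pow[OF hom x M is_group] by simp
  have one: "h \<one>\<^bsub>mmc_group m\<^esub> = \<one>\<^bsub>A\<^esub>" by (rule hom_one[OF hom M is_group])
  have "h x [^]\<^bsub>A\<^esub> ((2::nat) ^ Suc m) = \<one>\<^bsub>A\<^esub>"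
    by (simp only: pow mmc_a_pow[of m, folded x_def] one)
  moreover have "h x [^]\<^bsub>A\<^esub> ((2::nat) ^ m) \<noteq> \<one>\<^bsub>A\<^esub>"
  proof
    assume "h x [^]\<^bsub>A\<^esub> ((2::nat) ^ m) = \<one>\<^bsub>A\<^esub>"
    then have "h (x [^]\<^bsub>mmc_group m\<^esub> ((2::nat) ^ m)) = h \<one>\<^bsub>mmc_group m\<^esub>"
      unfolding pow one .
    moreover have "x [^]\<^bsub>mmc_group m\<^esub> ((2::nat) ^ m) \<in> carrier (mmc_group m)"
      using M x by (simp add: group.is_monoid monoid.nat_pow_closed)
    ultimately have "x [^]\<^bsub>mmc_group m\<^esub> ((2::nat) ^ m) = \<one>\<^bsub>mmc_group m\<^esub>"
      using bij M by (meson bij_betw_imp_inj_on group.is_monoid inj_onD monoid.one_closed)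
    then show False using mmc_a_pow_neq[OF assms(2)] by (simp add: x_def)
  qed
  ultimately show "\<exists>a\<in>carrier A. a [^]\<^bsub>A\<^esub> ((2::nat) ^ Suc m) = \<one>\<^bsub>A\<^esub> \<and> a [^]\<^bsub>A\<^esub> ((2::nat) ^ m) \<noteq> \<one>\<^bsub>A\<^esub>"
    using hom x by (auto simp: hom_def)
qed

theorem theorem5p4:
  fixes m :: nat and A :: "('a, 'r) ring_scheme"
  assumes "m \<ge> 3"
    and "mmc_brace m A"
    and "\<not> cyclic_group (add_monoid A)"
  shows "add_monoid A \<cong> integer_mod_group 2 \<times>\<times> integer_mod_group (2 ^ (m + 1))"
proof -
  interpret mmc_brace m A by fact
  have "m \<ge> 1" using assms(1) by simp
  note elem = mmc_brace_element[OF assms(2) this]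
  have fin: "finite (carrier A)" and card_le: "card (carrier A) \<le> 2 * 2 ^ Suc m"
    using elem(1,2) by simp_all
  obtain a where a: "a \<in> carrier A" "a [^]\<^bsub>A\<^esub> ((2::nat) ^ Suc m) = \<one>\<^bsub>A\<^esub>"
    "a [^]\<^bsub>A\<^esub> ((2::nat) ^ m) \<noteq> \<one>\<^bsub>A\<^esub>"
    using elem(3) by blast
  \<comment> \<open>The adjoint order of \<open>a\<close> divides the size, which is at most twice
    that order.\<close>
  have "2 ^ Suc m dvd card (carrier A)"
    using ord_dvd_group_order[OF a(1)] ord_eq_two_power[OF a] by (simp add: Coset.order_def)
  then obtain r where r: "card (carrier A) = 2 ^ Suc m * r" by blast
  moreover have "card (carrier A) > 0" using fin a(1) card_gt_0_iff by blast
  ultimately have "r = 1 \<or> r = 2" using card_le by (cases r) auto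
  then have dvd: "card (carrier A) dvd 2 ^ (m + 2)" using r by auto
  let ?G = "add_monoid A"
  have additive: "group ?G" by (rule a_group)
  interpret orbit: polynomial_orbit ?G "\<lambda>x. lam a x \<ominus>\<^bsub>A\<^esub> x" a by (rule lam_orbit[OF a(1)])
  have pow_eq: "a [^]\<^bsub>A\<^esub> ((2::nat) ^ k) = orbit.orb (doubling_poly k)" for k
    using pow_two_power_eq_orb[OF a(1)] by blast
  \<comment> \<open>The circle power of \<open>a\<close> with exponent \<open>2 ^ Suc m\<close> is
    the common neutral element, so \<open>doubling_poly (Suc m)\<close> annihilates
    \<open>a\<close>.\<close>
  interpret nil: nilpotent_polynomial_orbit ?G "\<lambda>x. lam a x \<ominus>\<^bsub>A\<^esub> x" a "m + 2" "Suc m"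
    using dvd pow_eq[of "Suc m"] a(2)
    by unfold_locales (simp_all add: zero_eq_one del: doubling_poly.simps)
  \<comment> \<open>Here \<open>n - 2\<close> is \<open>m\<close>, and \<open>m \<ge> 3\<close>
    gives \<open>n \<ge> 5\<close>.\<close>
  have "orbit.orb (2 ^ m) \<noteq> \<one>\<^bsub>?G\<^esub>"
    using nil.orb_two_power_neq_one pow_eq[of m] a(3) assms(1)
    by (simp add: zero_eq_one del: doubling_poly.simps)
  then have neq: "a [^]\<^bsub>?G\<^esub> ((2::nat) ^ m) \<noteq> \<one>\<^bsub>?G\<^esub>"
    using orbit.orb_of_nat[of "2 ^ m"] by simp
  have "group.ord ?G a dvd 2 ^ (m + 2)"
    using group.ord_dvd_group_order[OF additive, of a] a(1) dvd by (simp add: Coset.order_def dvd_trans)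
  then obtain i where i: "i \<le> m + 2" "group.ord ?G a = 2 ^ i"
    using divides_primepow_nat[OF two_is_prime_nat] by blast
  \<comment> \<open>The additive order of \<open>a\<close> is at least \<open>2 ^ Suc m\<close> and,
    without cyclicity, a proper divisor of the size; this fixes both.\<close>
  have "\<not> i \<le> m"
    using neq group.pow_eq_id[OF additive, of a "2 ^ m"] a(1) i(2) le_imp_power_dvd by auto
  moreover have ord_neq: "group.ord ?G a \<noteq> card (carrier A)"
    using group.cyclic_group_if_ord_eq_order[OF additive, of a] fin a(1) assms(3) by auto
  moreover have "group.ord ?G a dvd card (carrier A)"
    using group.ord_dvd_group_order[OF additive, of a] a(1) by (simp add: Coset.order_def)
  ultimately have "i = Suc m" "card (carrier A) = 2 * 2 ^ Suc m"
    using i r \<open>r = 1 \<or> r = 2\<close> by (auto simp: le_Suc_eq dest!: dvd_imp_le)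
  then show ?thesis
    using comm_group.iso_Z2_times_cyclic[OF a_comm_group, of a "Suc m"] fin a(1) i(2) assms(3) by simp
qed

end
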